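(* Let $\mathfrak{g}=(\mathfrak{g}_{-1}\xrightarrow{l_1}\mathfrak{g}_0,\ l_2=l_2^0+l_2^1,\ l_3)$ be a $2$-term $L_\infty$-algebra and let $\tilde{\mathfrak{g}}=(\mathfrak{g}_{-1}\xrightarrow{\tilde l_1}\mathfrak{g}_0\oplus(\mathfrak{g}_0^*\otimes\mathfrak{g}_{-1}),\tilde l_2,\tilde l_3)$ be the $2$-term $L_\infty$-algebra constructed from it (defined in the context). Then there is an $L_\infty$-algebra homomorphism $F=(F_0=\mathrm{pr}_1,\,F_1=\mathrm{id},\,F_2)$ from $\tilde{\mathfrak{g}}$ to $\mathfrak{g}$, where $\mathrm{pr}_1:\mathfrak{g}_0\oplus(\mathfrak{g}_0^*\otimes\mathfrak{g}_{-1})\to\mathfrak{g}_0$ is the projection to the first component and $F_2:\wedge^2(\mathfrak{g}_0\oplus(\mathfrak{g}_0^*\otimes\mathfrak{g}_{-1}))\to\mathfrak{g}_{-1}$ is given by $$F_2(x+\xi\otimes m,\,y+\eta\otimes n)=\tfrac12\big(\langle\xi,y\rangle m-\langle x,\eta\rangle n\big)$$ for all $x,y\in\mathfrak{g}_0$ and $\xi\otimes m,\eta\otimes n\in\mathfrak{g}_0^*\otimes\mathfrak{g}_{-1}$.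
   Context: All vector spaces are real and finite-dimensional. A $2$-term $L_\infty$-algebra $(\mathfrak{g}_{-1}\xrightarrow{l_1}\mathfrak{g}_0,l_2=l_2^0+l_2^1,l_3)$ consists of a linear map $l_1:\mathfrak{g}_{-1}\to\mathfrak{g}_0$, maps $l_2^0:\wedge^2\mathfrak{g}_0\to\mathfrak{g}_0$, $l_2^1:\mathfrak{g}_0\otimes\mathfrak{g}_{-1}\to\mathfrak{g}_{-1}$ (with $l_2(m,x)=-l_2(x,m)$, $l_2(m,n)=0$) and $l_3:\wedge^3\mathfrak{g}_0\to\mathfrak{g}_{-1}$, with, for $x,y,z,x_i\in\mathfrak{g}_0$, $m,n\in\mathfrak{g}_{-1}$: $l_1l_2(x,m)=l_2(x,l_1m)$; $l_2(l_1m,n)=l_2(m,l_1n)$; $l_2(l_2(x,y),z)+c.p.+l_1l_3(x,y,z)=0$; $l_2(l_2(x,y),m)+l_2(l_2(y,m),x)+l_2(l_2(m,x),y)+l_3(x,y,l_1m)=0$; $\sum_{\sigma}\mathrm{sgn}(\sigma)l_3(l_2(x_{\sigma(1)},x_{\sigma(2)}),x_{\sigma(3)},x_{\sigma(4)})=\sum_{\tau}\mathrm{sgn}(\tau)l_2(l_3(x_{\tau(1)},x_{\tau(2)},x_{\tau(3)}),x_{\tau(4)})$, $\sigma$ over $(2,2)$- and $\tau$ over $(3,1)$-unshuffles. "$c.p.$" denotes the cyclic permutations of the three arguments. An $L_\infty$-algebra homomorphism $F:\mathfrak{g}\to\mathfrak{g}'$ of $2$-term $L_\infty$-algebras consists of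 linear maps $F_0:\mathfrak{g}_0\to\mathfrak{g}_0'$, $F_1:\mathfrak{g}_{-1}\to\mathfrak{g}_{-1}'$, $F_2:\wedge^2\mathfrak{g}_0\to\mathfrak{g}_{-1}'$ such that for all $x,y,z\in\mathfrak{g}_0$, $m\in\mathfrak{g}_{-1}$: (i) $F_0\circ l_1=l_1'\circ F_1$; (ii) $F_0l_2(x,y)-l_2'(F_0x,F_0y)=l_1'F_2(x,y)$; (iii) $F_1l_2(x,m)-l_2'(F_0x,F_1m)=F_2(x,l_1m)$; (iv) $F_2(l_2(x,y),z)+c.p.+F_1(l_3(x,y,z))=l_2'(F_0x,F_2(y,z))+c.p.+l_3'(F_0x,F_0y,F_0z)$. Notation: $\langle l_1^*\xi,m\rangle=-\langle\xi,l_1(m)\rangle$; $\langle l_2^0(x,\cdot)^*\xi,y\rangle=-\langle\xi,l_2^0(x,y)\rangle$; $l_2^1(m,\cdot)$ and $l_3(x,y,\cdot)$ are elements of $\mathrm{Hom}(\mathfrak{g}_0,\mathfrak{g}_{-1})=\mathfrak{g}_0^*\otimes\mathfrak{g}_{-1}$. The $2$-term $L_\infty$-algebra $\tilde{\mathfrak{g}}$ has degree $-1$ part $\mathfrak{g}_{-1}$, degree $0$ part $\mathfrak{g}_0\oplus(\mathfrak{g}_0^*\otimes\mathfrak{g}_{-1})$, and operations $\tilde l_1(m)=l_1(m)-l_2^1(m,\cdot)$; $\tilde l_2^0$ skew-symmetric with $\tilde l_2^0(x,y)=l_2^0(x,y)+l_3(x,y,\cdot)$, $\tilde l_2^0(x,\xi\otimes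 m)=\xi\otimes l_2^1(x,m)+(l_2^0(x,\cdot)^*\xi)\otimes m-\frac12\xi(x)(l_1(m)-l_2^1(m,\cdot))$, $\tilde l_2^0(\xi\otimes m,\eta\otimes n)=\langle l_1^*\eta,m\rangle\xi\otimes n-\langle l_1^*\xi,n\rangle\eta\otimes m$; $\tilde l_2^1(x+\xi\otimes m,n)=\frac12l_2^1(x,n)+\frac12\langle\xi,l_1(n)\rangle m$; $$\begin{aligned}&\tilde l_3(x_1+\xi_1\otimes m_1,x_2+\xi_2\otimes m_2,x_3+\xi_3\otimes m_3)=-\tfrac12 l_3(x_1,x_2,x_3)-\tfrac12\big(\langle l_2^0(x_1,x_2),\xi_3\rangle m_3+c.p.\big)\\&-\tfrac14\big(\langle\xi_1,x_2\rangle\langle\xi_3,l_1m_1\rangle m_3-\langle\xi_2,x_1\rangle\langle\xi_3,l_1m_2\rangle m_3+c.p.\big)-\tfrac14\big(\langle\xi_2,x_3\rangle l_2^1(x_1,m_2)-\langle\xi_3,x_2\rangle l_2^1(x_1,m_3)+c.p.\big),\end{aligned}$$ with $c.p.$ over cyclic permutations of the indices $1,2,3$. *)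

theory Defs
  imports "HOL-Analysis.Linear_Algebra" "HOL-Combinatorics.Permutations"
begin

section \<open>Finite-dimensional real vector spaces and linear maps\<close>

text \<open>
  Unlike \<^class>\<open>euclidean_space\<close>, this class carries no inner product and allows dimension 0.
  Class assumptions cannot mention \<^const>\<open>span\<close>; the lemma after the class restates the assumption
  as \<open>span B = UNIV\<close>.
\<close>

class fin_dim_real_vector = real_vector +
  assumes finite_spanning_raw:
    "\<exists>B. finite B \<and> (\<forall>S. B \<subseteq> S \<and> 0 \<in> S \<and> (\<forall>x\<in>S. \<forall>y\<in>S. x + y \<in> S)
       \<and> (\<forall>c. \<forall>x\<in>S. c *\<^sub>R x \<in> S) \<longrightarrow> S = UNIV)"

lemma finite_spanning_iff:
  "(\<exists>B :: 'a::real_vector set. finite B \<and> (\<forall>S. B \<subseteq> S \<and> 0 \<in> S \<and> (\<forall>x\<in>S. \<forall>y\<in>S. x + y \<in> S)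
       \<and> (\<forall>c. \<forall>x\<in>S. c *\<^sub>R x \<in> S) \<longrightarrow> S = UNIV))
   \<longleftrightarrow> (\<exists>B :: 'a set. finite B \<and> span B = UNIV)"
proof -
  have "(\<forall>S. B \<subseteq> S \<and> subspace S \<longrightarrow> S = UNIV) \<longleftrightarrow> span B = UNIV" for B :: "'a set"
    using span_minimal[of B] subspace_span[of B] span_superset[of B] by blast
  then show ?thesis
    by (simp add: subspace_def)
qed

lemma finite_spanning: "\<exists>B :: 'a::fin_dim_real_vector set. finite B \<and> span B = UNIV"
  using finite_spanning_raw finite_spanning_iff by blast

typedef (overloaded) ('a::real_vector, 'b::real_vector) linmap = "{f :: 'a \<Rightarrow> 'b. linear f}"
  morphisms app Linmap
  by (rule exI[of _ "\<lambda>x. 0"]) (simp add: module_hom_zero)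

notation app (\<open>\<langle>_, _\<rangle>\<close>)

setup_lifting type_definition_linmap

type_synonym 'a dual = "('a, real) linmap"

instantiation linmap :: (real_vector, real_vector) real_vector
begin

lift_definition zero_linmap :: "('a, 'b) linmap" is "\<lambda>x. 0"
  by (simp add: module_hom_zero)

lift_definition plus_linmap :: "('a, 'b) linmap \<Rightarrow> ('a, 'b) linmap \<Rightarrow> ('a, 'b) linmap"
  is "\<lambda>f g x. f x + g x"
  by (rule linear_compose_add)

lift_definition minus_linmap :: "('a, 'b) linmap \<Rightarrow> ('a, 'b) linmap \<Rightarrow> ('a, 'b) linmap"
  is "\<lambda>f g x. f x - g x"
  by (rule linear_compose_sub)

lift_definition uminus_linmap :: "('a, 'b) linmap \<Rightarrow> ('a, 'b) linmap"
  is "\<lambda>f x. - f x"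
  by (rule linear_compose_neg)

lift_definition scaleR_linmap :: "real \<Rightarrow> ('a, 'b) linmap \<Rightarrow> ('a, 'b) linmap"
  is "\<lambda>r f x. r *\<^sub>R f x"
  by (rule linear_compose_scale_right)

instance
  by standard (transfer; auto simp: algebra_simps)+

end

lemma linear_app: "linear (app f)"
  using app[of f] by simp

lemma app_Linmap: "linear f \<Longrightarrow> app (Linmap f) = f"
  by (simp add: Linmap_inverse)

lemma linmap_eqI: "(\<And>x. \<langle>f, x\<rangle> = \<langle>g, x\<rangle>) \<Longrightarrow> f = g"
  by transfer auto

lemma app_simps [simp]:
  "\<langle>0, x\<rangle> = 0" "\<langle>f + g, x\<rangle> = \<langle>f, x\<rangle> + \<langle>g, x\<rangle>" "\<langle>f - g, x\<rangle> = \<langle>f, x\<rangle> - \<langle>g, x\<rangle>"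
  "\<langle>- f, x\<rangle> = - \<langle>f, x\<rangle>" "\<langle>r *\<^sub>R f, x\<rangle> = r *\<^sub>R \<langle>f, x\<rangle>"
  by (transfer; simp)+

lemma linear_app_left: "linear (\<lambda>f. \<langle>f, x\<rangle>)"
  by (rule linearI) simp_all


section \<open>Hom(V, W) as the tensor product of the dual of V with W\<close>

definition tensor :: "'a::real_vector dual \<Rightarrow> 'b::real_vector \<Rightarrow> ('a, 'b) linmap" (infixr \<open>\<otimes>\<close> 75)
  where "\<xi> \<otimes> m = Linmap (\<lambda>x. \<langle>\<xi>, x\<rangle> *\<^sub>R m)"

definition basis :: "'a::real_vector set"
  where "basis = extend_basis {}"

definition dual_basis :: "'a::real_vector \<Rightarrow> 'a dual"
  where "dual_basis e = Linmap (\<lambda>v. representation basis v e)"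

text \<open>
  The linear extension, from pure tensors to all of Hom(V, W), of a bilinear map \<open>b\<close> on pairs
  \<open>(\<xi>, m)\<close>.  It is computed from the decomposition of \<open>f\<close> as the sum of the pure tensors
  \<open>dual_basis e \<otimes> \<langle>f, e\<rangle>\<close>, and is characterised (independently of the basis) by
  \<open>linear_tensor_lift\<close>, \<open>tensor_lift_tensor\<close> and \<open>linear_eq_on_tensors\<close> below.
\<close>

definition tensor_lift ::
  "('a::real_vector dual \<Rightarrow> 'b::real_vector \<Rightarrow> 'c::real_vector) \<Rightarrow> ('a, 'b) linmap \<Rightarrow> 'c"
  where "tensor_lift b f = (\<Sum>e\<in>basis. b (dual_basis e) \<langle>f, e\<rangle>)"

lemma independent_basis: "independent (basis :: 'a::real_vector set)"
  and span_basis: "span (basis :: 'a::real_vector set) = UNIV"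
  unfolding basis_def
  using independent_extend_basis[OF independent_empty] span_extend_basis[OF independent_empty]
  by auto

lemma finite_basis: "finite (basis :: 'a::fin_dim_real_vector set)"
proof -
  obtain B :: "'a set" where "finite B" "span B = UNIV"
    using finite_spanning by blast
  then show ?thesis
    using independent_span_bound[of B basis] independent_basis by auto
qed

lemma app_tensor [simp]: "\<langle>\<xi> \<otimes> m, x\<rangle> = \<langle>\<xi>, x\<rangle> *\<^sub>R m"
proof -
  have "linear (\<lambda>x. \<langle>\<xi>, x\<rangle> *\<^sub>R m)"
    by (rule linearI)
      (simp_all add: linear_add[OF linear_app] linear_cmul[OF linear_app] algebra_simps)
  then show ?thesis
    by (simp add: tensor_def app_Linmap)
qed

lemma app_dual_basis: "\<langle>dual_basis e, v\<rangle> = representation basis v e"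
proof -
  have "linear (\<lambda>v. representation basis v e)"
    by (rule linearI)
      (simp_all add: representation_add representation_scale independent_basis span_basis)
  then show ?thesis
    by (simp add: dual_basis_def app_Linmap)
qed

lemma sum_dual_basis:
  "(\<Sum>e\<in>basis. \<langle>dual_basis e, v\<rangle> *\<^sub>R e) = (v :: 'a::fin_dim_real_vector)"
  unfolding app_dual_basis
  by (rule sum_representation_eq)
    (auto simp: independent_basis span_basis finite_basis)

lemma app_sum: "\<langle>\<Sum>i\<in>I. f i, x\<rangle> = (\<Sum>i\<in>I. \<langle>f i, x\<rangle>)"
  by (rule linear_sum[OF linear_app_left])

lemma sum_tensors:
  fixes f :: "('a::fin_dim_real_vector, 'b::real_vector) linmap"
  shows "f = (\<Sum>e\<in>basis. dual_basis e \<otimes> \<langle>f, e\<rangle>)"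
proof (rule linmap_eqI)
  fix x
  have "\<langle>f, x\<rangle> = \<langle>f, \<Sum>e\<in>basis. \<langle>dual_basis e, x\<rangle> *\<^sub>R e\<rangle>"
    by (simp add: sum_dual_basis)
  also have "\<dots> = \<langle>\<Sum>e\<in>basis. dual_basis e \<otimes> \<langle>f, e\<rangle>, x\<rangle>"
    by (simp add: linear_sum[OF linear_app] linear_cmul[OF linear_app] app_sum)
  finally show "\<langle>f, x\<rangle> = \<langle>\<Sum>e\<in>basis. dual_basis e \<otimes> \<langle>f, e\<rangle>, x\<rangle>" .
qed

lemma bilinear_tensor: "bilinear (\<otimes>)"
  unfolding bilinear_def
  by (auto intro!: linearI linmap_eqI simp: algebra_simps)

lemma linear_tensor_lift:
  assumes "bilinear b"
  shows "linear (tensor_lift b)"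
  by (rule linearI)
    (simp_all add: tensor_lift_def bilinear_radd[OF assms] bilinear_rmul[OF assms]
      sum.distrib scaleR_sum_right)

lemma tensor_lift_tensor:
  fixes \<xi> :: "'a::fin_dim_real_vector dual"
  assumes b: "bilinear b"
  shows "tensor_lift b (\<xi> \<otimes> m) = b \<xi> m"
proof -
  have l: "linear (\<lambda>\<eta>. b \<eta> m)"
    using b unfolding bilinear_def by blast
  have "(\<Sum>e\<in>basis. \<langle>\<xi>, e\<rangle> *\<^sub>R dual_basis e) = \<xi>"
    by (rule linmap_eqI, subst (2) sum_tensors[of \<xi>]) (simp add: app_sum mult.commute)
  then have "b \<xi> m = b (\<Sum>e\<in>basis. \<langle>\<xi>, e\<rangle> *\<^sub>R dual_basis e) m"
    by simp
  also have "\<dots> = tensor_lift b (\<xi> \<otimes> m)"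
    by (simp add: tensor_lift_def linear_sum[OF l] bilinear_lmul[OF b] bilinear_rmul[OF b])
  finally show ?thesis by simp
qed

lemma linear_eq_on_tensors:
  fixes f g :: "('a::fin_dim_real_vector, 'b::real_vector) linmap \<Rightarrow> 'c::real_vector"
  assumes f: "linear f" and g: "linear g" and eq: "\<And>\<xi> m. f (\<xi> \<otimes> m) = g (\<xi> \<otimes> m)"
  shows "f = g"
proof
  fix h
  show "f h = g h"
    by (subst (1 2) sum_tensors[of h]) (simp add: linear_sum[OF f] linear_sum[OF g] eq)
qed

instance prod :: (fin_dim_real_vector, fin_dim_real_vector) fin_dim_real_vector
proof (standard, unfold finite_spanning_iff)
  let ?B = "(\<lambda>x. (x, 0)) ` basis \<union> (\<lambda>y. (0, y)) ` basis :: ('a \<times> 'b) set"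
  have l: "linear (\<lambda>x::'a. (x, 0::'b))" "linear (\<lambda>y::'b. (0::'a, y))"
    by (rule linearI; simp)+
  have "(x, y) \<in> span ?B" for x y
  proof -
    have "(x, 0) \<in> span ?B"
      using linear_span_image[OF l(1), of basis] span_basis span_mono[of "(\<lambda>x. (x, 0)) ` basis" ?B]
      by auto
    moreover have "(0, y) \<in> span ?B"
      using linear_span_image[OF l(2), of basis] span_basis span_mono[of "(\<lambda>y. (0, y)) ` basis" ?B]
      by auto
    ultimately have "(x, 0) + (0, y) \<in> span ?B"
      by (rule span_add)
    then show ?thesis by simp
  qed
  then show "\<exists>B :: ('a \<times> 'b) set. finite B \<and> span B = UNIV"
    by (intro exI[of _ ?B]) (auto simp: finite_basis)
qed

instance linmap :: (fin_dim_real_vector, fin_dim_real_vector) fin_dim_real_vector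
proof (standard, unfold finite_spanning_iff)
  let ?B = "(\<lambda>(e, m). dual_basis e \<otimes> m) ` (basis \<times> basis) :: ('a, 'b) linmap set"
  have "dual_basis e \<otimes> m \<in> span ?B" if "e \<in> basis" for e m
  proof -
    have l: "linear (\<lambda>m. dual_basis e \<otimes> m)"
      using bilinear_tensor unfolding bilinear_def by blast
    have "(\<lambda>m. dual_basis e \<otimes> m) ` basis \<subseteq> ?B"
      using that by auto
    then show ?thesis
      using linear_span_image[OF l, of basis] span_basis span_mono by blast
  qed
  then have "f \<in> span ?B" for f
    by (subst sum_tensors[of f]) (rule span_sum)
  then show "\<exists>B :: ('a, 'b) linmap set. finite B \<and> span B = UNIV"
    by (intro exI[of _ ?B]) (auto simp: finite_basis)
qed


section \<open>2-term L-infinity-algebras and their homomorphisms\<close>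

definition trilinear ::
  "('a::real_vector \<Rightarrow> 'a \<Rightarrow> 'a \<Rightarrow> 'b::real_vector) \<Rightarrow> bool"
  where "trilinear f \<longleftrightarrow>
    (\<forall>y z. linear (\<lambda>x. f x y z)) \<and> (\<forall>x z. linear (\<lambda>y. f x y z)) \<and> (\<forall>x y. linear (\<lambda>z. f x y z))"

definition cyc :: "('a \<Rightarrow> 'a \<Rightarrow> 'a \<Rightarrow> 'b::real_vector) \<Rightarrow> 'a \<Rightarrow> 'a \<Rightarrow> 'a \<Rightarrow> 'b"
  where "cyc f x y z = f x y z + f y z x + f z x y"

definition unshuffles :: "nat \<Rightarrow> nat \<Rightarrow> (nat \<Rightarrow> nat) set"
  where "unshuffles p q = {\<sigma>. \<sigma> permutes {1..p + q} \<and>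
    strict_mono_on {1..p} \<sigma> \<and> strict_mono_on {p + 1..p + q} \<sigma>}"

text \<open>\<open>'a\<close> is the degree 0 part and \<open>'b\<close> the degree -1 part.\<close>

record ('a, 'b) two_term =
  l1 :: "'b \<Rightarrow> 'a"
  l20 :: "'a \<Rightarrow> 'a \<Rightarrow> 'a"
  l21 :: "'a \<Rightarrow> 'b \<Rightarrow> 'b"
  l3 :: "'a \<Rightarrow> 'a \<Rightarrow> 'a \<Rightarrow> 'b"

text \<open>The bracket of degrees (-1, 0), determined by that of degrees (0, -1).\<close>

definition l21op :: "('a, 'b::real_vector) two_term \<Rightarrow> 'b \<Rightarrow> 'a \<Rightarrow> 'b"
  where "l21op A m x = - l21 A x m"

definition two_term_Linf ::
  "('a::fin_dim_real_vector, 'b::fin_dim_real_vector) two_term \<Rightarrow> bool"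
  where "two_term_Linf A \<longleftrightarrow>
    linear (l1 A) \<and>
    bilinear (l20 A) \<and> (\<forall>x. l20 A x x = 0) \<and>
    bilinear (l21 A) \<and>
    trilinear (l3 A) \<and> (\<forall>x y. l3 A x x y = 0 \<and> l3 A x y y = 0 \<and> l3 A x y x = 0) \<and>
    (\<forall>x m. l1 A (l21 A x m) = l20 A x (l1 A m)) \<and>
    (\<forall>m n. l21 A (l1 A m) n = l21op A m (l1 A n)) \<and>
    (\<forall>x y z. cyc (\<lambda>x y z. l20 A (l20 A x y) z) x y z + l1 A (l3 A x y z) = 0) \<and>
    (\<forall>x y m. l21 A (l20 A x y) m + l21op A (l21 A y m) x + l21op A (l21op A m x) y
       + l3 A x y (l1 A m) = 0) \<and>
    (\<forall>x :: nat \<Rightarrow> 'a.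
       (\<Sum>\<sigma>\<in>unshuffles 2 2. of_int (sign \<sigma>) *\<^sub>R
          l3 A (l20 A (x (\<sigma> 1)) (x (\<sigma> 2))) (x (\<sigma> 3)) (x (\<sigma> 4))) =
       (\<Sum>\<tau>\<in>unshuffles 3 1. of_int (sign \<tau>) *\<^sub>R
          l21op A (l3 A (x (\<tau> 1)) (x (\<tau> 2)) (x (\<tau> 3))) (x (\<tau> 4))))"

definition Linf_hom ::
  "('a::fin_dim_real_vector, 'b::fin_dim_real_vector) two_term \<Rightarrow>
   ('c::fin_dim_real_vector, 'd::fin_dim_real_vector) two_term \<Rightarrow>
   ('a \<Rightarrow> 'c) \<Rightarrow> ('b \<Rightarrow> 'd) \<Rightarrow> ('a \<Rightarrow> 'a \<Rightarrow> 'd) \<Rightarrow> bool"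
  where "Linf_hom A A' F0 F1 F2 \<longleftrightarrow>
    two_term_Linf A \<and> two_term_Linf A' \<and>
    linear F0 \<and> linear F1 \<and> bilinear F2 \<and> (\<forall>x. F2 x x = 0) \<and>
    F0 \<circ> l1 A = l1 A' \<circ> F1 \<and>
    (\<forall>x y. F0 (l20 A x y) - l20 A' (F0 x) (F0 y) = l1 A' (F2 x y)) \<and>
    (\<forall>x m. F1 (l21 A x m) - l21 A' (F0 x) (F1 m) = F2 x (l1 A m)) \<and>
    (\<forall>x y z. cyc (\<lambda>x y z. F2 (l20 A x y) z) x y z + F1 (l3 A x y z) =
       cyc (\<lambda>x y z. l21 A' (F0 x) (F2 y z)) x y z + l3 A' (F0 x) (F0 y) (F0 z))"


section \<open>The 2-term L-infinity-algebra on V + Hom(V, W)\<close>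

text \<open>Transpose with the sign convention used for coadjoint actions.\<close>

definition neg_transpose :: "('a::real_vector \<Rightarrow> 'b::real_vector) \<Rightarrow> 'b dual \<Rightarrow> 'a dual"
  where "neg_transpose f \<xi> = Linmap (\<lambda>v. - \<langle>\<xi>, f v\<rangle>)"

definition tl1 ::
  "('a::real_vector, 'b::real_vector) two_term \<Rightarrow> 'b \<Rightarrow> 'a \<times> ('a, 'b) linmap"
  where "tl1 A m = (l1 A m, - Linmap (l21op A m))"

text \<open>The bracket of \<open>x\<close> in V with an element of Hom(V, W).\<close>

definition tl20_mixed ::
  "('a::real_vector, 'b::real_vector) two_term \<Rightarrow> 'a \<Rightarrow> ('a, 'b) linmap \<Rightarrow> 'a \<times> ('a, 'b) linmap"
  where "tl20_mixed A x = tensor_lift (\<lambda>\<xi> m.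
    (0, \<xi> \<otimes> l21 A x m + neg_transpose (l20 A x) \<xi> \<otimes> m)
    - (1/2 * \<langle>\<xi>, x\<rangle>) *\<^sub>R (l1 A m, - Linmap (l21op A m)))"

definition tl20_hom ::
  "('a::real_vector, 'b::real_vector) two_term \<Rightarrow>
   ('a, 'b) linmap \<Rightarrow> ('a, 'b) linmap \<Rightarrow> ('a, 'b) linmap"
  where "tl20_hom A \<phi> \<psi> = tensor_lift (\<lambda>\<xi> m. tensor_lift (\<lambda>\<eta> n.
    \<langle>neg_transpose (l1 A) \<eta>, m\<rangle> *\<^sub>R (\<xi> \<otimes> n) - \<langle>neg_transpose (l1 A) \<xi>, n\<rangle> *\<^sub>R (\<eta> \<otimes> m)) \<psi>) \<phi>"

definition tl20 ::
  "('a::real_vector, 'b::real_vector) two_term \<Rightarrow>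
   'a \<times> ('a, 'b) linmap \<Rightarrow> 'a \<times> ('a, 'b) linmap \<Rightarrow> 'a \<times> ('a, 'b) linmap"
  where "tl20 A = (\<lambda>(x, \<phi>) (y, \<psi>).
    (l20 A x y, Linmap (l3 A x y)) + tl20_mixed A x \<psi> - tl20_mixed A y \<phi> + (0, tl20_hom A \<phi> \<psi>))"

definition tl21 ::
  "('a::real_vector, 'b::real_vector) two_term \<Rightarrow> 'a \<times> ('a, 'b) linmap \<Rightarrow> 'b \<Rightarrow> 'b"
  where "tl21 A = (\<lambda>(x, \<phi>) n.
    (1/2) *\<^sub>R l21 A x n + (1/2) *\<^sub>R tensor_lift (\<lambda>\<xi> m. \<langle>\<xi>, l1 A n\<rangle> *\<^sub>R m) \<phi>)"

definition tl3 ::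
  "('a::real_vector, 'b::real_vector) two_term \<Rightarrow>
   'a \<times> ('a, 'b) linmap \<Rightarrow> 'a \<times> ('a, 'b) linmap \<Rightarrow> 'a \<times> ('a, 'b) linmap \<Rightarrow> 'b"
  where "tl3 A X1 X2 X3 =
    - (1/2) *\<^sub>R l3 A (fst X1) (fst X2) (fst X3)
    - (1/2) *\<^sub>R cyc (\<lambda>(x1, \<phi>1) (x2, \<phi>2) (x3, \<phi>3).
        tensor_lift (\<lambda>\<xi>3 m3. \<langle>\<xi>3, l20 A x1 x2\<rangle> *\<^sub>R m3) \<phi>3) X1 X2 X3
    - (1/4) *\<^sub>R cyc (\<lambda>(x1, \<phi>1) (x2, \<phi>2) (x3, \<phi>3).
        tensor_lift (\<lambda>\<xi>1 m1. tensor_lift (\<lambda>\<xi>3 m3.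
          (\<langle>\<xi>1, x2\<rangle> * \<langle>\<xi>3, l1 A m1\<rangle>) *\<^sub>R m3) \<phi>3) \<phi>1
        - tensor_lift (\<lambda>\<xi>2 m2. tensor_lift (\<lambda>\<xi>3 m3.
          (\<langle>\<xi>2, x1\<rangle> * \<langle>\<xi>3, l1 A m2\<rangle>) *\<^sub>R m3) \<phi>3) \<phi>2) X1 X2 X3
    - (1/4) *\<^sub>R cyc (\<lambda>(x1, \<phi>1) (x2, \<phi>2) (x3, \<phi>3).
        tensor_lift (\<lambda>\<xi>2 m2. \<langle>\<xi>2, x3\<rangle> *\<^sub>R l21 A x1 m2) \<phi>2
        - tensor_lift (\<lambda>\<xi>3 m3. \<langle>\<xi>3, x2\<rangle> *\<^sub>R l21 A x1 m3) \<phi>3) X1 X2 X3"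

definition tilde ::
  "('a::real_vector, 'b::real_vector) two_term \<Rightarrow> ('a \<times> ('a, 'b) linmap, 'b) two_term"
  where "tilde A = \<lparr>l1 = tl1 A, l20 = tl20 A, l21 = tl21 A, l3 = tl3 A\<rparr>"


section \<open>The operations on pure tensors\<close>

context
  fixes A :: "('a::fin_dim_real_vector, 'b::fin_dim_real_vector) two_term"
  assumes A: "two_term_Linf A"
begin

lemma lin:
  "linear (l1 A)" "bilinear (l20 A)" "bilinear (l21 A)" "trilinear (l3 A)"
  using A by (simp_all add: two_term_Linf_def)

lemma app_l21op: "\<langle>Linmap (l21op A m), x\<rangle> = l21op A m x"
proof -
  have "linear (l21op A m)"
    unfolding l21op_def
    by (rule linearI) (simp_all add: bilinear_ladd[OF lin(3)] bilinear_lmul[OF lin(3)])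
  then show ?thesis by (simp add: app_Linmap)
qed

lemma app_l3: "\<langle>Linmap (l3 A x y), z\<rangle> = l3 A x y z"
  using lin(4) by (simp add: trilinear_def app_Linmap)

lemma app_neg_transpose: "linear f \<Longrightarrow> \<langle>neg_transpose f \<xi>, v\<rangle> = - \<langle>\<xi>, f v\<rangle>"
  unfolding neg_transpose_def
  by (subst app_Linmap) (auto intro!: linearI simp: linear_add linear_cmul linear_add[OF linear_app] linear_cmul[OF linear_app])

lemmas app_dual =
  app_neg_transpose[OF lin(1)] app_neg_transpose[OF lin(2)[unfolded bilinear_def, THEN conjunct1, rule_format]]

lemmas expand =
  linear_add[OF lin(1)] linear_cmul[OF lin(1)]
  bilinear_ladd[OF lin(2)] bilinear_lmul[OF lin(2)] bilinear_radd[OF lin(2)] bilinear_rmul[OF lin(2)]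
  bilinear_ladd[OF lin(3)] bilinear_lmul[OF lin(3)] bilinear_radd[OF lin(3)] bilinear_rmul[OF lin(3)]
  linear_add[OF linear_app] linear_cmul[OF linear_app] app_l21op app_dual l21op_def


lemma tl20_mixed_tensor:
  "tl20_mixed A x (\<xi> \<otimes> m) =
    (0, \<xi> \<otimes> l21 A x m + neg_transpose (l20 A x) \<xi> \<otimes> m)
    - (1/2 * \<langle>\<xi>, x\<rangle>) *\<^sub>R (l1 A m, - Linmap (l21op A m))"
  unfolding tl20_mixed_def
  by (rule tensor_lift_tensor, unfold bilinear_def, intro conjI allI linearI)
    (rule prod_eqI; (rule linmap_eqI)?; simp add: expand scaleR_left_distrib scaleR_right_distrib scaleR_left_diff_distrib scaleR_right_diff_distrib
        add_divide_distrib mult_ac)+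

lemma tl20_hom_tensors:
  "tl20_hom A (\<xi> \<otimes> m) (\<eta> \<otimes> n) =
    \<langle>neg_transpose (l1 A) \<eta>, m\<rangle> *\<^sub>R (\<xi> \<otimes> n) - \<langle>neg_transpose (l1 A) \<xi>, n\<rangle> *\<^sub>R (\<eta> \<otimes> m)"
proof -
  define b where "b = (\<lambda>\<xi> m (\<eta> :: 'a dual) (n :: 'b).
    \<langle>neg_transpose (l1 A) \<eta>, m\<rangle> *\<^sub>R (\<xi> \<otimes> n) - \<langle>neg_transpose (l1 A) \<xi>, n\<rangle> *\<^sub>R (\<eta> \<otimes> m))"
  have b: "bilinear (b \<xi> m)" for \<xi> m
    unfolding bilinear_def b_def by (auto intro!: linearI linmap_eqI simp: expand algebra_simps)
  have "bilinear (\<lambda>\<xi> m. tensor_lift (b \<xi> m) \<psi>)" for \<psi>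
    unfolding bilinear_def tensor_lift_def b_def
    by (auto intro!: linearI linmap_eqI
        simp: expand app_sum algebra_simps sum.distrib sum_subtractf sum_negf sum_distrib_left scaleR_sum_right)
  from tensor_lift_tensor[OF this[of "\<eta> \<otimes> n"], of \<xi> m]
  have "tensor_lift (\<lambda>\<xi> m. tensor_lift (b \<xi> m) (\<eta> \<otimes> n)) (\<xi> \<otimes> m) = b \<xi> m \<eta> n"
    by (simp only: tensor_lift_tensor[OF b])
  moreover have "tl20_hom A \<phi> \<psi> = tensor_lift (\<lambda>\<xi> m. tensor_lift (b \<xi> m) \<psi>) \<phi>" for \<phi> \<psi>
    by (simp add: tl20_hom_def b_def)
  ultimately have "tl20_hom A (\<xi> \<otimes> m) (\<eta> \<otimes> n) = b \<xi> m \<eta> n"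
    by simp
  then show ?thesis by (simp add: b_def)
qed

lemma tensor_lift_contract:
  fixes v :: 'a and T :: "'b \<Rightarrow> 'c::real_vector"
  assumes "linear T"
  shows "tensor_lift (\<lambda>\<xi> m. \<langle>\<xi>, v\<rangle> *\<^sub>R T m) f = T \<langle>f, v\<rangle>"
proof -
  have "bilinear (\<lambda>\<xi> m. \<langle>\<xi>, v\<rangle> *\<^sub>R T m)"
    unfolding bilinear_def
    by (auto intro!: linearI simp: linear_add[OF assms] linear_cmul[OF assms] algebra_simps)
  moreover have "linear (\<lambda>f. T \<langle>f, v\<rangle>)"
    by (rule linearI) (simp_all add: linear_add[OF assms] linear_cmul[OF assms])
  ultimately have "tensor_lift (\<lambda>\<xi> m. \<langle>\<xi>, v\<rangle> *\<^sub>R T m) = (\<lambda>f. T \<langle>f, v\<rangle>)"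
    by (intro linear_eq_on_tensors)
      (simp_all only: linear_tensor_lift tensor_lift_tensor app_tensor linear_cmul[OF assms])
  then show ?thesis
    by (rule fun_cong)
qed

lemma tl21_tensor:
  "tl21 A (x, \<xi> \<otimes> m) n = (1/2) *\<^sub>R l21 A x n + (1/2) *\<^sub>R (\<langle>\<xi>, l1 A n\<rangle> *\<^sub>R m)"
  by (simp add: tl21_def tensor_lift_contract[OF linear_ident])

lemma tl3_tensors:
  "tl3 A (x1, \<xi>1 \<otimes> m1) (x2, \<xi>2 \<otimes> m2) (x3, \<xi>3 \<otimes> m3) =
    - (1/2) *\<^sub>R l3 A x1 x2 x3
    - (1/2) *\<^sub>R (\<langle>\<xi>3, l20 A x1 x2\<rangle> *\<^sub>R m3 + \<langle>\<xi>1, l20 A x2 x3\<rangle> *\<^sub>R m1 + \<langle>\<xi>2, l20 A x3 x1\<rangle> *\<^sub>R m2)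
    - (1/4) *\<^sub>R (
        ((\<langle>\<xi>1, x2\<rangle> * \<langle>\<xi>3, l1 A m1\<rangle>) *\<^sub>R m3 - (\<langle>\<xi>2, x1\<rangle> * \<langle>\<xi>3, l1 A m2\<rangle>) *\<^sub>R m3)
      + ((\<langle>\<xi>2, x3\<rangle> * \<langle>\<xi>1, l1 A m2\<rangle>) *\<^sub>R m1 - (\<langle>\<xi>3, x2\<rangle> * \<langle>\<xi>1, l1 A m3\<rangle>) *\<^sub>R m1)
      + ((\<langle>\<xi>3, x1\<rangle> * \<langle>\<xi>2, l1 A m3\<rangle>) *\<^sub>R m2 - (\<langle>\<xi>1, x3\<rangle> * \<langle>\<xi>2, l1 A m1\<rangle>) *\<^sub>R m2))
    - (1/4) *\<^sub>R (
        (\<langle>\<xi>2, x3\<rangle> *\<^sub>R l21 A x1 m2 - \<langle>\<xi>3, x2\<rangle> *\<^sub>R l21 A x1 m3)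
      + (\<langle>\<xi>3, x1\<rangle> *\<^sub>R l21 A x2 m3 - \<langle>\<xi>1, x3\<rangle> *\<^sub>R l21 A x2 m1)
      + (\<langle>\<xi>1, x2\<rangle> *\<^sub>R l21 A x3 m1 - \<langle>\<xi>2, x1\<rangle> *\<^sub>R l21 A x3 m2))"
proof -
  have l: "linear (l21 A x)" for x
    using lin(3) unfolding bilinear_def by blast
  have scaled: "tensor_lift (\<lambda>\<eta> n. (c * \<langle>\<eta>, v\<rangle>) *\<^sub>R n) f = c *\<^sub>R \<langle>f, v\<rangle>"
    for c v and f :: "('a, 'b) linmap"
    using tensor_lift_contract[OF linear_compose_scale_right[OF linear_ident], of v c f]
    by (simp only: scaleR_scaleR mult.commute)
  have comp: "linear (\<lambda>m. \<langle>f, l1 A m\<rangle>)" for f :: "('a, 'b) linmap"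
    using linear_compose[OF lin(1) linear_app, of f] by (simp add: o_def)
  show ?thesis
    unfolding tl3_def cyc_def
    by (simp only: prod.case fst_conv scaled tensor_lift_contract[OF linear_ident]
        tensor_lift_contract[OF comp] tensor_lift_contract[OF l] app_tensor
        linear_cmul[OF lin(1)] linear_cmul[OF l] linear_cmul[OF linear_app] scaleR_scaleR)
qed

end

end

theory Submission
  imports Defs
begin

text \<open>
  Let \<open>d\<close> be the differential of \<open>A\<close>.  On \<open>V \<oplus> Hom(V, W)\<close> there is a simpler 2-term
  \<open>L\<^sub>\<infinity>\<close>-algebra: \<open>V\<close> acts on \<open>Hom(V, W)\<close> by \<open>(x \<cdot> \<psi>)(z) = x \<cdot> \<psi>(z) - \<psi>([x, z])\<close>, the
  bracket of \<open>Hom(V, W)\<close> is \<open>\<phi> d \<psi> - \<psi> d \<phi>\<close>, the bracket of \<open>V\<close> is corrected by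
  \<open>l\<^sub>3(x, y, \<cdot>)\<close>, and the action on \<open>W\<close> and the ternary bracket are pulled back along
  \<open>pr\<^sub>1\<close>, which thereby becomes a strict homomorphism to \<open>A\<close>.
  For every alternating bilinear \<open>\<theta>\<close> with values in degree -1, a 2-term
  \<open>L\<^sub>\<infinity>\<close>-structure can be transported along \<open>(id, id, \<theta>)\<close>.  Transporting the simpler
  structure along \<open>\<theta>(x + \<phi>, y + \<psi>) = (\<phi>(y) - \<psi>(x))/2\<close> gives exactly the structure of the
  theorem, and composing \<open>(id, id, \<theta>)\<close> with \<open>pr\<^sub>1\<close> gives the homomorphism.
\<close>

section \<open>Unshuffle sums and the laws in elementwise form\<close>

lemma strict_mono_on_pair:
  fixes f :: "nat \<Rightarrow> nat"
  shows "strict_mono_on {1..2} f \<longleftrightarrow> f 1 < f 2" "strict_mono_on {3..4} f \<longleftrightarrow> f 3 < f 4"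
proof -
  have "{1..2::nat} = {1, 2}" "{3..4::nat} = {3, 4}" by auto
  then show "strict_mono_on {1..2} f \<longleftrightarrow> f 1 < f 2" "strict_mono_on {3..4} f \<longleftrightarrow> f 3 < f 4"
    by (auto simp: strict_mono_on_def)
qed

lemma strict_mono_on_triple:
  fixes f :: "nat \<Rightarrow> nat"
  shows "strict_mono_on {1..3} f \<longleftrightarrow> f 1 < f 2 \<and> f 2 < f 3" "strict_mono_on {4..4} f"
proof -
  have "{1..3::nat} = {1, 2, 3}" by auto
  then show "strict_mono_on {1..3} f \<longleftrightarrow> f 1 < f 2 \<and> f 2 < f 3" "strict_mono_on {4..4} f"
    by (auto simp: strict_mono_on_def)
qed

text \<open>Monotonicity on the two blocks cuts the unshuffles out of all permutations of
  \<open>{1, 2, 3, 4}\<close>. As a conditional sum over all of these, the sum is expanded by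
  inserting one point at a time, which writes every permutation as a product of transpositions of
  known sign.\<close>

lemma sum_unshuffles_eq:
  fixes f :: "nat \<Rightarrow> nat \<Rightarrow> nat \<Rightarrow> nat \<Rightarrow> 'c::real_vector"
  shows sum_unshuffles_2_2:
    "(\<Sum>\<sigma>\<in>unshuffles 2 2. of_int (sign \<sigma>) *\<^sub>R f (\<sigma> 1) (\<sigma> 2) (\<sigma> 3) (\<sigma> 4)) =
      f 1 2 3 4 - f 1 3 2 4 + f 1 4 2 3 + f 2 3 1 4 - f 2 4 1 3 + f 3 4 1 2"
  and sum_unshuffles_3_1:
    "(\<Sum>\<sigma>\<in>unshuffles 3 1. of_int (sign \<sigma>) *\<^sub>R f (\<sigma> 1) (\<sigma> 2) (\<sigma> 3) (\<sigma> 4)) =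
      f 1 2 3 4 - f 1 2 4 3 + f 1 3 4 2 - f 2 3 4 1"
proof -
  let ?g = "\<lambda>\<sigma>. of_int (sign \<sigma>) *\<^sub>R f (\<sigma> 1) (\<sigma> 2) (\<sigma> 3) (\<sigma> 4)"
  have perms: "{1..4::nat} = {1, 2, 3, 4}" by auto
  have fin: "finite {\<sigma>. \<sigma> permutes {1, 2, 3, 4::nat}}"
    by (simp add: finite_permutations)
  have "unshuffles 2 2 = {\<sigma> \<in> {\<sigma>. \<sigma> permutes {1, 2, 3, 4}}. \<sigma> 1 < \<sigma> 2 \<and> \<sigma> 3 < \<sigma> 4}"
    by (auto simp: unshuffles_def strict_mono_on_pair[simplified] perms[simplified])
  then have "sum ?g (unshuffles 2 2) =
      (\<Sum>\<sigma> | \<sigma> permutes {1, 2, 3, 4}. if \<sigma> 1 < \<sigma> 2 \<and> \<sigma> 3 < \<sigma> 4 then ?g \<sigma> else 0)"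
    by (simp only: sum.inter_filter[OF fin])
  also have "\<dots> = f 1 2 3 4 - f 1 3 2 4 + f 1 4 2 3 + f 2 3 1 4 - f 2 4 1 3 + f 3 4 1 2"
    by (simp add: sum_over_permutations_insert sign_compose permutation_compose permutation_swap_id
        sign_swap_id transpose_def)
  finally show "sum ?g (unshuffles 2 2) =
      f 1 2 3 4 - f 1 3 2 4 + f 1 4 2 3 + f 2 3 1 4 - f 2 4 1 3 + f 3 4 1 2" .
  have "unshuffles 3 1 = {\<sigma> \<in> {\<sigma>. \<sigma> permutes {1, 2, 3, 4}}. \<sigma> 1 < \<sigma> 2 \<and> \<sigma> 2 < \<sigma> 3}"
    by (auto simp: unshuffles_def strict_mono_on_triple[simplified] perms[simplified])
  then have "sum ?g (unshuffles 3 1) =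
      (\<Sum>\<sigma> | \<sigma> permutes {1, 2, 3, 4}. if \<sigma> 1 < \<sigma> 2 \<and> \<sigma> 2 < \<sigma> 3 then ?g \<sigma> else 0)"
    by (simp only: sum.inter_filter[OF fin])
  also have "\<dots> = f 1 2 3 4 - f 1 2 4 3 + f 1 3 4 2 - f 2 3 4 1"
    by (simp add: sum_over_permutations_insert sign_compose permutation_compose permutation_swap_id
        sign_swap_id transpose_def)
  finally show "sum ?g (unshuffles 3 1) = f 1 2 3 4 - f 1 2 4 3 + f 1 3 4 2 - f 2 3 4 1" .
qed

text \<open>Working form of the axioms: \<open>l21op\<close>, \<open>cyc\<close> and the
  permutations are gone, and the law relating \<open>l3\<close> to the action is solved for
  \<open>l3\<close> on a boundary.\<close>

lemma two_term_Linf_iff: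
  fixes A :: "('a::fin_dim_real_vector, 'b::fin_dim_real_vector) two_term"
  shows "two_term_Linf A \<longleftrightarrow>
    linear (l1 A) \<and>
    bilinear (l20 A) \<and> (\<forall>x. l20 A x x = 0) \<and>
    bilinear (l21 A) \<and>
    trilinear (l3 A) \<and> (\<forall>x y. l3 A x x y = 0 \<and> l3 A x y y = 0 \<and> l3 A x y x = 0) \<and>
    (\<forall>x m. l1 A (l21 A x m) = l20 A x (l1 A m)) \<and>
    (\<forall>m n. l21 A (l1 A m) n = - l21 A (l1 A n) m) \<and>
    (\<forall>x y z. l20 A (l20 A x y) z + l20 A (l20 A y z) x + l20 A (l20 A z x) y + l1 A (l3 A x y z) = 0) \<and>
    (\<forall>x y m. l3 A x y (l1 A m) = l21 A x (l21 A y m) - l21 A y (l21 A x m) - l21 A (l20 A x y) m) \<and>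
    (\<forall>x1 x2 x3 x4. l3 A (l20 A x1 x2) x3 x4 - l3 A (l20 A x1 x3) x2 x4 + l3 A (l20 A x1 x4) x2 x3
       + l3 A (l20 A x2 x3) x1 x4 - l3 A (l20 A x2 x4) x1 x3 + l3 A (l20 A x3 x4) x1 x2 =
       - l21 A x4 (l3 A x1 x2 x3) + l21 A x3 (l3 A x1 x2 x4)
       - l21 A x2 (l3 A x1 x3 x4) + l21 A x1 (l3 A x2 x3 x4))"
proof -
  let ?C = "\<lambda>x1 x2 x3 x4. l3 A (l20 A x1 x2) x3 x4 - l3 A (l20 A x1 x3) x2 x4 + l3 A (l20 A x1 x4) x2 x3
       + l3 A (l20 A x2 x3) x1 x4 - l3 A (l20 A x2 x4) x1 x3 + l3 A (l20 A x3 x4) x1 x2 =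
       - l21 A x4 (l3 A x1 x2 x3) + l21 A x3 (l3 A x1 x2 x4)
       - l21 A x2 (l3 A x1 x3 x4) + l21 A x1 (l3 A x2 x3 x4)"
  have coherence: "(\<forall>x :: nat \<Rightarrow> 'a.
       (\<Sum>\<sigma>\<in>unshuffles 2 2. of_int (sign \<sigma>) *\<^sub>R
          l3 A (l20 A (x (\<sigma> 1)) (x (\<sigma> 2))) (x (\<sigma> 3)) (x (\<sigma> 4))) =
       (\<Sum>\<tau>\<in>unshuffles 3 1. of_int (sign \<tau>) *\<^sub>R
          l21op A (l3 A (x (\<tau> 1)) (x (\<tau> 2)) (x (\<tau> 3))) (x (\<tau> 4))))
     \<longleftrightarrow> (\<forall>x1 x2 x3 x4. ?C x1 x2 x3 x4)" (is "?L \<longleftrightarrow> ?R")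
  proof -
    have "?L \<longleftrightarrow> (\<forall>x :: nat \<Rightarrow> 'a. ?C (x 1) (x 2) (x 3) (x 4))"
      unfolding sum_unshuffles_2_2[where f = "\<lambda>i j k l. l3 A (l20 A (x i) (x j)) (x k) (x l)" for x]
        sum_unshuffles_3_1[where f = "\<lambda>i j k l. l21op A (l3 A (x i) (x j) (x k)) (x l)" for x]
      by (simp add: l21op_def)
    also have "\<dots> \<longleftrightarrow> ?R"
    proof safe
      fix x1 x2 x3 x4
      assume "\<forall>x :: nat \<Rightarrow> 'a. ?C (x 1) (x 2) (x 3) (x 4)"
      \<comment> \<open>Only indices 1 to 4 are read, so the default value \<open>x4\<close> serves
        as the entry at 4.\<close>
      from this[rule_format, of "(\<lambda>i. x4)(1 := x1, 2 := x2, 3 := x3)"]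
      show "?C x1 x2 x3 x4" by simp
    qed blast
    finally show ?thesis .
  qed
  have action: "l21 A (l20 A x y) m + l21op A (l21 A y m) x + l21op A (l21op A m x) y + l3 A x y (l1 A m) = 0
      \<longleftrightarrow> l3 A x y (l1 A m) = l21 A x (l21 A y m) - l21 A y (l21 A x m) - l21 A (l20 A x y) m"
    if "bilinear (l21 A)" for x y m
    using that by (auto simp: l21op_def bilinear_rneg algebra_simps add_eq_0_iff2)
  show ?thesis
    unfolding two_term_Linf_def coherence cyc_def l21op_def[of A m "l1 A n" for m n]
    using action by (auto simp only:)
qed

section \<open>Multilinear and skew-symmetric calculus\<close>

lemmas bilinear_simps =
  bilinear_ladd bilinear_radd bilinear_lsub bilinear_rsub bilinear_lneg bilinear_rneg
  bilinear_lmul bilinear_rmul bilinear_lzero bilinear_rzero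

lemmas linear_simps = linear_add linear_diff linear_neg linear_cmul linear_0

lemma trilinear_simps:
  assumes "trilinear f"
  shows "f (x + x') y z = f x y z + f x' y z" "f x (y + y') z = f x y z + f x y' z"
    "f x y (z + z') = f x y z + f x y z'"
    "f (x - x') y z = f x y z - f x' y z" "f x (y - y') z = f x y z - f x y' z"
    "f x y (z - z') = f x y z - f x y z'"
    "f (- x) y z = - f x y z" "f x (- y) z = - f x y z" "f x y (- z) = - f x y z"
    "f (c *\<^sub>R x) y z = c *\<^sub>R f x y z" "f x (c *\<^sub>R y) z = c *\<^sub>R f x y z"
    "f x y (c *\<^sub>R z) = c *\<^sub>R f x y z"
proof -
  have b: "bilinear (\<lambda>x y. f x y z)" "bilinear (\<lambda>y z. f x y z)" for x z
    using assms unfolding trilinear_def bilinear_def by blast+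
  show "f (x + x') y z = f x y z + f x' y z" "f x (y + y') z = f x y z + f x y' z"
    "f x y (z + z') = f x y z + f x y z'"
    "f (x - x') y z = f x y z - f x' y z" "f x (y - y') z = f x y z - f x y' z"
    "f x y (z - z') = f x y z - f x y z'"
    "f (- x) y z = - f x y z" "f x (- y) z = - f x y z" "f x y (- z) = - f x y z"
    "f (c *\<^sub>R x) y z = c *\<^sub>R f x y z" "f x (c *\<^sub>R y) z = c *\<^sub>R f x y z"
    "f x y (c *\<^sub>R z) = c *\<^sub>R f x y z"
    by (rule bilinear_simps[OF b(1)] bilinear_simps[OF b(2)])+
qed

lemma alternating_imp_skew:
  assumes b: "bilinear b" and alt: "\<And>x. b x x = 0"
  shows "b x y = - b y x"
proof -
  have "b (x + y) (x + y) = b x y + b y x"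
    by (simp only: bilinear_ladd[OF b] bilinear_radd[OF b]) (simp add: alt)
  then have "b x y + b y x = 0"
    by (simp only: alt)
  then show ?thesis
    by (simp only: eq_neg_iff_add_eq_0)
qed

context
  fixes A :: "('a::fin_dim_real_vector, 'b::fin_dim_real_vector) two_term"
  assumes A: "two_term_Linf A"
begin

text \<open>\<open>l1_l21\<close>, \<open>l1_l3\<close> and \<open>l3_l1\<close> are oriented for
  rewriting: they remove \<open>l1\<close> from the front of an action or of \<open>l3\<close>, and
  \<open>l3\<close> from a boundary in its last slot. \<open>l21_l1\<close> would loop, so it is
  used only in chosen instances.\<close>

lemma l3_alternating: "l3 A x x y = 0" "l3 A x y y = 0" "l3 A x y x = 0"
  and l20_alternating: "l20 A x x = 0"
  and l1_l21: "l1 A (l21 A x m) = l20 A x (l1 A m)"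
  and l21_l1: "l21 A (l1 A m) n = - l21 A (l1 A n) m"
  and l1_l3: "l1 A (l3 A x y z) = - (l20 A (l20 A x y) z + l20 A (l20 A y z) x + l20 A (l20 A z x) y)"
  and l3_l1: "l3 A x y (l1 A m) = l21 A x (l21 A y m) - l21 A y (l21 A x m) - l21 A (l20 A x y) m"
  and l3_coherence:
    "l3 A (l20 A x y) z w - l3 A (l20 A x z) y w + l3 A (l20 A x w) y z
       + l3 A (l20 A y z) x w - l3 A (l20 A y w) x z + l3 A (l20 A z w) x y =
       - l21 A w (l3 A x y z) + l21 A z (l3 A x y w)
       - l21 A y (l3 A x z w) + l21 A x (l3 A y z w)"
  using A unfolding two_term_Linf_iff eq_neg_iff_add_eq_0
  by (blast, blast, blast, blast, blast, metis add.commute neg_eq_iff_add_eq_0, metis add.commute,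
      blast, blast)

lemma l20_skew: "l20 A x y = - l20 A y x"
  by (rule alternating_imp_skew[OF lin(2)[OF A] l20_alternating])

lemma l3_skew: "l3 A x y z = - l3 A y x z" "l3 A x y z = - l3 A x z y"
proof -
  have "bilinear (\<lambda>x y. l3 A x y z)" "bilinear (\<lambda>y z. l3 A x y z)" for x z
    using lin(4)[OF A] unfolding trilinear_def bilinear_def by blast+
  from alternating_imp_skew[OF this(1)[of z] l3_alternating(1), of x y]
    alternating_imp_skew[OF this(2)[of x] l3_alternating(2), of y z]
  show "l3 A x y z = - l3 A y x z" "l3 A x y z = - l3 A x z y" .
qed

lemma l3_cycle: "l3 A y z x = l3 A x y z" "l3 A z x y = l3 A x y z"
  using l3_skew by (metis minus_minus)+

lemmas multilinear =
  linear_simps[OF lin(1)[OF A]] bilinear_simps[OF lin(2)[OF A]] bilinear_simps[OF lin(3)[OF A]]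
  trilinear_simps[OF lin(4)[OF A]]

end

section \<open>Transport of structure along an alternating form\<close>

text \<open>The structure for which \<open>(id, id, \<theta>)\<close> is a homomorphism to \<open>A\<close>; that
  condition determines all four operations.\<close>

definition twist ::
  "('a::real_vector, 'b::real_vector) two_term \<Rightarrow> ('a \<Rightarrow> 'a \<Rightarrow> 'b) \<Rightarrow> ('a, 'b) two_term"
  where "twist A \<theta> = \<lparr>
    l1 = l1 A,
    l20 = \<lambda>x y. l20 A x y + l1 A (\<theta> x y),
    l21 = \<lambda>x m. l21 A x m + \<theta> x (l1 A m),
    l3 = \<lambda>x y z. l3 A x y z + cyc (\<lambda>x y z. l21 A x (\<theta> y z)) x y z
      - cyc (\<lambda>x y z. \<theta> (l20 A x y + l1 A (\<theta> x y)) z) x y z\<rparr>"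

text \<open>Both sides are expanded as polynomials in \<open>\<theta>\<close>. The part free of
  \<open>\<theta>\<close> is the coherence law of \<open>A\<close>. In the rest, \<open>l3 A\<close>
  on boundaries becomes iterated actions and \<open>l1 A\<close> of \<open>l3 A\<close> becomes
  iterated brackets, after which everything cancels by skew symmetry.\<close>

lemma twist_coherence:
  assumes A: "two_term_Linf A" and \<theta>: "bilinear \<theta>" and alt: "\<And>x. \<theta> x x = 0"
  defines "B \<equiv> twist A \<theta>"
  shows "l3 B (l20 B x y) z w - l3 B (l20 B x z) y w + l3 B (l20 B x w) y z
       + l3 B (l20 B y z) x w - l3 B (l20 B y w) x z + l3 B (l20 B z w) x y =
       - l21 B w (l3 B x y z) + l21 B z (l3 B x y w)
       - l21 B y (l3 B x z w) + l21 B x (l3 B y z w)"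
proof -
  note lins = multilinear[OF A] bilinear_simps[OF \<theta>]
  note \<theta>_skew = alternating_imp_skew[OF \<theta> alt]
  note skew = l20_skew[OF A] l3_skew[OF A] \<theta>_skew
  txt \<open>
    General skew symmetry would loop as a rewrite rule; its instances below, oriented by
    \<open>x < y < z < w\<close>, bring every term to a normal form.
  \<close>
  have ordered: "l20 A y x = - l20 A x y" "l20 A z x = - l20 A x z" "l20 A w x = - l20 A x w"
    "l20 A z y = - l20 A y z" "l20 A w y = - l20 A y w" "l20 A w z = - l20 A z w"
    "\<theta> y x = - \<theta> x y" "\<theta> z x = - \<theta> x z" "\<theta> w x = - \<theta> x w"
    "\<theta> z y = - \<theta> y z" "\<theta> w y = - \<theta> y w" "\<theta> w z = - \<theta> z w"
    by (rule skew)+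
  have l3_ordered: "l3 A p y x = - l3 A p x y" "l3 A p z x = - l3 A p x z" "l3 A p w x = - l3 A p x w"
    "l3 A p z y = - l3 A p y z" "l3 A p w y = - l3 A p y w" "l3 A p w z = - l3 A p z w" for p
    by (rule skew)+
  have brackets: "l20 A x (l20 A u v) = - l20 A (l20 A u v) x" "l20 A y (l20 A u v) = - l20 A (l20 A u v) y"
    "l20 A z (l20 A u v) = - l20 A (l20 A u v) z" "l20 A w (l20 A u v) = - l20 A (l20 A u v) w"
    "\<theta> (l20 A u v) x = - \<theta> x (l20 A u v)" "\<theta> (l20 A u v) y = - \<theta> y (l20 A u v)"
    "\<theta> (l20 A u v) z = - \<theta> z (l20 A u v)" "\<theta> (l20 A u v) w = - \<theta> w (l20 A u v)" for u v
    by (rule skew)+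
  have double_brackets: "\<theta> (l20 A z w) (l20 A x y) = - \<theta> (l20 A x y) (l20 A z w)"
    "\<theta> (l20 A y w) (l20 A x z) = - \<theta> (l20 A x z) (l20 A y w)"
    "\<theta> (l20 A y z) (l20 A x w) = - \<theta> (l20 A x w) (l20 A y z)"
    by (rule skew)+
  have boundaries: "l20 A (l1 A m) x = - l20 A x (l1 A m)" "l20 A (l1 A m) y = - l20 A y (l1 A m)"
    "l20 A (l1 A m) z = - l20 A z (l1 A m)" "l20 A (l1 A m) w = - l20 A w (l1 A m)"
    "\<theta> (l1 A m) x = - \<theta> x (l1 A m)" "\<theta> (l1 A m) y = - \<theta> y (l1 A m)"
    "\<theta> (l1 A m) z = - \<theta> z (l1 A m)" "\<theta> (l1 A m) w = - \<theta> w (l1 A m)"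
    "\<theta> (l1 A m) (l20 A u v) = - \<theta> (l20 A u v) (l1 A m)" for u v m
    by (rule skew)+
  have double_boundaries: "\<theta> (l1 A (\<theta> z w)) (l1 A (\<theta> x y)) = - \<theta> (l1 A (\<theta> x y)) (l1 A (\<theta> z w))"
    "\<theta> (l1 A (\<theta> y w)) (l1 A (\<theta> x z)) = - \<theta> (l1 A (\<theta> x z)) (l1 A (\<theta> y w))"
    "\<theta> (l1 A (\<theta> y z)) (l1 A (\<theta> x w)) = - \<theta> (l1 A (\<theta> x w)) (l1 A (\<theta> y z))"
    "l21 A (l1 A (\<theta> z w)) (\<theta> x y) = - l21 A (l1 A (\<theta> x y)) (\<theta> z w)"
    "l21 A (l1 A (\<theta> y w)) (\<theta> x z) = - l21 A (l1 A (\<theta> x z)) (\<theta> y w)"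
    "l21 A (l1 A (\<theta> y z)) (\<theta> x w) = - l21 A (l1 A (\<theta> x w)) (\<theta> y z)"
    by (rule skew l21_l1[OF A])+
  \<comment> \<open>The twisted bracket puts boundaries into the first slot of \<open>l3 A\<close>;
    cyclic invariance moves them to the last, where \<open>l3_l1\<close> applies.\<close>
  have l3_d: "l3 A (l1 A m) u v = l21 A u (l21 A v m) - l21 A v (l21 A u m) - l21 A (l20 A u v) m" for m u v
    by (metis l3_l1[OF A] l3_cycle[OF A])
  \<comment> \<open>Solved for a single term, the law becomes a terminating rewrite rule for these
    four vectors.\<close>
  have coherence: "l3 A (l20 A x y) z w = l3 A (l20 A x z) y w - l3 A (l20 A x w) y z
       - l3 A (l20 A y z) x w + l3 A (l20 A y w) x z - l3 A (l20 A z w) x y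
       - l21 A w (l3 A x y z) + l21 A z (l3 A x y w)
       - l21 A y (l3 A x z w) + l21 A x (l3 A y z w)"
    using l3_coherence[OF A, of x y z w] by (simp add: algebra_simps)
  show ?thesis
    unfolding B_def twist_def
    by (simp add: cyc_def lins ordered l3_ordered brackets double_brackets boundaries
        double_boundaries l3_d l1_l21[OF A] l1_l3[OF A] coherence)
qed

lemma trilinear_add: "trilinear f \<Longrightarrow> trilinear g \<Longrightarrow> trilinear (\<lambda>x y z. f x y z + g x y z)"
  and trilinear_diff: "trilinear f \<Longrightarrow> trilinear g \<Longrightarrow> trilinear (\<lambda>x y z. f x y z - g x y z)"
  unfolding trilinear_def by (auto intro: linear_compose_add linear_compose_sub)

lemma trilinear_cyc: "trilinear f \<Longrightarrow> trilinear (cyc f)"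
  unfolding cyc_def trilinear_def by (auto intro!: linear_compose_add)

text \<open>Each law is the same law of \<open>A\<close> plus terms containing
  \<open>\<theta>\<close>; these cancel because \<open>l1 A\<close> is compatible with the brackets
  and \<open>\<theta>\<close> is skew.\<close>

lemma two_term_Linf_twist:
  assumes A: "two_term_Linf A" and \<theta>: "bilinear \<theta>" and alt: "\<And>x. \<theta> x x = 0"
  shows "two_term_Linf (twist A \<theta>)"
proof -
  note lins = multilinear[OF A] bilinear_simps[OF \<theta>]
  note \<theta>_skew = alternating_imp_skew[OF \<theta> alt]
  have lin_bilin: "linear (l1 (twist A \<theta>))" "bilinear (l20 (twist A \<theta>))" "bilinear (l21 (twist A \<theta>))"
    unfolding twist_def bilinear_def by (auto intro!: linearI simp: lins algebra_simps)
  have "trilinear (\<lambda>x y z. l21 A x (\<theta> y z))"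
    "trilinear (\<lambda>x y z. \<theta> (l20 A x y + l1 A (\<theta> x y)) z)"
    unfolding trilinear_def by (auto intro!: linearI simp: lins algebra_simps)
  then have trilin: "trilinear (l3 (twist A \<theta>))"
    unfolding twist_def using lin(4)[OF A]
    by (simp add: trilinear_add trilinear_diff trilinear_cyc)
  have alternating: "l3 (twist A \<theta>) x x y = 0" "l3 (twist A \<theta>) x y y = 0" "l3 (twist A \<theta>) x y x = 0" for x y
    using \<theta>_skew[of x y] l20_skew[OF A, of x y]
    by (simp_all add: twist_def cyc_def lins l3_alternating[OF A] l20_alternating[OF A] alt)
  have jacobi: "l20 (twist A \<theta>) (l20 (twist A \<theta>) x y) z + l20 (twist A \<theta>) (l20 (twist A \<theta>) y z) x
      + l20 (twist A \<theta>) (l20 (twist A \<theta>) z x) y + l1 (twist A \<theta>) (l3 (twist A \<theta>) x y z) = 0" for x y z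
  proof -
    have "l20 A (l1 A m) x = - l20 A x (l1 A m)" "l20 A (l1 A m) y = - l20 A y (l1 A m)"
      "l20 A (l1 A m) z = - l20 A z (l1 A m)" for m
      by (rule l20_skew[OF A])+
    then show ?thesis
      by (simp add: twist_def cyc_def lins l1_l21[OF A] l1_l3[OF A])
  qed
  have action: "l3 (twist A \<theta>) x y (l1 (twist A \<theta>) m) =
      l21 (twist A \<theta>) x (l21 (twist A \<theta>) y m) - l21 (twist A \<theta>) y (l21 (twist A \<theta>) x m)
      - l21 (twist A \<theta>) (l20 (twist A \<theta>) x y) m" for x y m
  proof -
    have "l20 A (l1 A m) x = - l20 A x (l1 A m)" "\<theta> (l1 A n) x = - \<theta> x (l1 A n)"
      "\<theta> (l1 A n) y = - \<theta> y (l1 A n)" "\<theta> (l20 A u v) x = - \<theta> x (l20 A u v)"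
      "\<theta> (l20 A u v) y = - \<theta> y (l20 A u v)" for n u v
      by (rule l20_skew[OF A] \<theta>_skew)+
    \<comment> \<open>The left term comes from the cyclic sum in the twisted \<open>l3\<close>, the
      right one from the action of the correction \<open>l1 A (\<theta> x y)\<close> to the
      bracket.\<close>
    moreover have "l21 A (l1 A m) (\<theta> x y) = - l21 A (l1 A (\<theta> x y)) m"
      by (rule l21_l1[OF A])
    ultimately show ?thesis
      by (simp add: twist_def cyc_def lins l1_l21[OF A] l3_l1[OF A])
  qed
  have alternating2: "l20 (twist A \<theta>) x x = 0" for x
    by (simp add: twist_def alt l20_alternating[OF A] lins)
  have d_bracket: "l1 (twist A \<theta>) (l21 (twist A \<theta>) x m) = l20 (twist A \<theta>) x (l1 (twist A \<theta>) m)" for x m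
    by (simp add: twist_def lins l1_l21[OF A])
  have d_skew: "l21 (twist A \<theta>) (l1 (twist A \<theta>) m) n = - l21 (twist A \<theta>) (l1 (twist A \<theta>) n) m" for m n
    using l21_l1[OF A, of m n] \<theta>_skew[of "l1 A m" "l1 A n"] by (simp add: twist_def)
  show ?thesis
    unfolding two_term_Linf_iff
    by (intro conjI allI; rule lin_bilin trilin alternating alternating2 d_bracket d_skew jacobi action
        twist_coherence[OF assms])
qed

section \<open>The extension of \<open>A\<close> by Hom(V, W)\<close>

text \<open>The Hom component is given by its values instead of by tensors, so that identities in it
  can be checked at a point \<open>z\<close>.\<close>

definition hom_extension ::
  "('a::real_vector, 'b::real_vector) two_term \<Rightarrow> ('a \<times> ('a, 'b) linmap, 'b) two_term"
  where "hom_extension A = \<lparr>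
    l1 = tl1 A,
    l20 = \<lambda>(x, \<phi>) (y, \<psi>). (l20 A x y, Linmap (\<lambda>z. l3 A x y z
      + (l21 A x \<langle>\<psi>, z\<rangle> - \<langle>\<psi>, l20 A x z\<rangle>) - (l21 A y \<langle>\<phi>, z\<rangle> - \<langle>\<phi>, l20 A y z\<rangle>)
      + \<langle>\<phi>, l1 A \<langle>\<psi>, z\<rangle>\<rangle> - \<langle>\<psi>, l1 A \<langle>\<phi>, z\<rangle>\<rangle>)),
    l21 = \<lambda>X. l21 A (fst X),
    l3 = \<lambda>X Y Z. l3 A (fst X) (fst Y) (fst Z)\<rparr>"

lemma prod_linmap_eqI:
  "fst p = fst q \<Longrightarrow> (\<And>z. \<langle>snd p, z\<rangle> = \<langle>snd q, z\<rangle>) \<Longrightarrow> p = q"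
  by (simp add: prod_eq_iff linmap_eqI)

context
  fixes A :: "('a::fin_dim_real_vector, 'b::fin_dim_real_vector) two_term"
  assumes A: "two_term_Linf A"
begin

lemma hom_extension_simps:
  "fst (l1 (hom_extension A) m) = l1 A m"
  "\<langle>snd (l1 (hom_extension A) m), z\<rangle> = l21 A z m"
  "fst (l20 (hom_extension A) X Y) = l20 A (fst X) (fst Y)"
  "\<langle>snd (l20 (hom_extension A) X Y), z\<rangle> = l3 A (fst X) (fst Y) z
      + (l21 A (fst X) \<langle>snd Y, z\<rangle> - \<langle>snd Y, l20 A (fst X) z\<rangle>)
      - (l21 A (fst Y) \<langle>snd X, z\<rangle> - \<langle>snd X, l20 A (fst Y) z\<rangle>)
      + \<langle>snd X, l1 A \<langle>snd Y, z\<rangle>\<rangle> - \<langle>snd Y, l1 A \<langle>snd X, z\<rangle>\<rangle>"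
  "l21 (hom_extension A) X m = l21 A (fst X) m"
  "l3 (hom_extension A) X Y Z = l3 A (fst X) (fst Y) (fst Z)"
proof -
  show "\<langle>snd (l20 (hom_extension A) X Y), z\<rangle> = l3 A (fst X) (fst Y) z
      + (l21 A (fst X) \<langle>snd Y, z\<rangle> - \<langle>snd Y, l20 A (fst X) z\<rangle>)
      - (l21 A (fst Y) \<langle>snd X, z\<rangle> - \<langle>snd X, l20 A (fst Y) z\<rangle>)
      + \<langle>snd X, l1 A \<langle>snd Y, z\<rangle>\<rangle> - \<langle>snd Y, l1 A \<langle>snd X, z\<rangle>\<rangle>"
    unfolding hom_extension_def case_prod_unfold two_term.simps snd_conv
    by (subst app_Linmap)
      (auto intro!: linearI simp: multilinear[OF A] linear_simps[OF linear_app] algebra_simps)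
qed (simp_all add: hom_extension_def tl1_def app_l21op[OF A] l21op_def case_prod_unfold)

text \<open>\<open>l21\<close> and \<open>l3\<close> see only first components, so the laws stated
  purely for them are those of \<open>A\<close>. Content lies in the Hom components: compatibility
  of \<open>l1\<close> with the bracket reduces to the action law of \<open>A\<close>, and the
  Jacobi law, evaluated at \<open>w\<close>, to the coherence law with \<open>w\<close> as fourth
  vector.\<close>

lemma two_term_Linf_hom_extension: "two_term_Linf (hom_extension A)"
proof -
  note lins = multilinear[OF A] linear_simps[OF linear_app]
  note ext = hom_extension_simps
  have lin: "linear (l1 (hom_extension A))" "bilinear (l20 (hom_extension A))"
    "bilinear (l21 (hom_extension A))" "trilinear (l3 (hom_extension A))"
    unfolding bilinear_def trilinear_def
    by (auto intro!: linearI prod_linmap_eqI simp: ext lins algebra_simps)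
  have alternating: "l20 (hom_extension A) X X = 0" for X
    by (rule prod_linmap_eqI) (simp_all add: ext l3_alternating[OF A] l20_alternating[OF A])
  have d_bracket: "l1 (hom_extension A) (l21 (hom_extension A) X m) =
      l20 (hom_extension A) X (l1 (hom_extension A) m)" for X m
  proof (rule prod_linmap_eqI)
    fix z
    have "l3 A (fst X) (l1 A m) z = - l3 A (fst X) z (l1 A m)"
      by (rule l3_skew[OF A])
    then show "\<langle>snd (l1 (hom_extension A) (l21 (hom_extension A) X m)), z\<rangle> =
      \<langle>snd (l20 (hom_extension A) X (l1 (hom_extension A) m)), z\<rangle>"
      using l20_skew[OF A, of "l1 A m" z] l21_l1[OF A, of m "\<langle>snd X, z\<rangle>"]
      by (simp add: ext lins l3_l1[OF A] l1_l21[OF A])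
  qed (simp add: ext l1_l21[OF A])
  have jacobi: "l20 (hom_extension A) (l20 (hom_extension A) X Y) Z
      + l20 (hom_extension A) (l20 (hom_extension A) Y Z) X
      + l20 (hom_extension A) (l20 (hom_extension A) Z X) Y
      + l1 (hom_extension A) (l3 (hom_extension A) X Y Z) = 0" for X Y Z
  proof (rule prod_linmap_eqI)
    fix w
    obtain x \<phi> y \<psi> z \<chi> where [simp]: "X = (x, \<phi>)" "Y = (y, \<psi>)" "Z = (z, \<chi>)"
      by (metis prod.exhaust)
    \<comment> \<open>The \<open>l3\<close> terms of \<open>jac\<close> and \<open>act\<close>
      cancel those arising when the Hom bracket composes \<open>l3 A u v\<close> with
      \<open>l1 A\<close> and an element of Hom(V, W).\<close>
    have jac: "l20 A (l20 A u v) w = l20 A u (l20 A v w) - l20 A v (l20 A u w) - l1 A (l3 A u v w)" for u v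
      using l20_skew[OF A, of "l20 A v w" u] l20_skew[OF A, of "l20 A w u" v] l20_skew[OF A, of w u]
      by (simp add: l1_l3[OF A] lins)
    have act: "l21 A (l20 A u v) m = l21 A u (l21 A v m) - l21 A v (l21 A u m) - l3 A u v (l1 A m)" for u v m
      by (simp add: l3_l1[OF A])
    have order: "l20 A z x = - l20 A x z" "l3 A z x v = - l3 A x z v"
      "l3 A (l20 A y w) z x = - l3 A (l20 A y w) x z" for v
      by (rule l20_skew[OF A] l3_skew[OF A])+
    have rotate: "l3 A u v (l20 A p w) = l3 A (l20 A p w) u v" for u v p
      by (rule l3_cycle(2)[OF A, symmetric])
    \<comment> \<open>This accounts for the terms free of \<open>\<phi>\<close>,
      \<open>\<psi>\<close> and \<open>\<chi>\<close>.\<close>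
    have coherence: "l3 A (l20 A x y) z w = l3 A (l20 A x z) y w - l3 A (l20 A x w) y z
       - l3 A (l20 A y z) x w + l3 A (l20 A y w) x z - l3 A (l20 A z w) x y
       - l21 A w (l3 A x y z) + l21 A z (l3 A x y w)
       - l21 A y (l3 A x z w) + l21 A x (l3 A y z w)"
      using l3_coherence[OF A, of x y z w] by (simp add: algebra_simps)
    show "\<langle>snd (l20 (hom_extension A) (l20 (hom_extension A) X Y) Z
      + l20 (hom_extension A) (l20 (hom_extension A) Y Z) X
      + l20 (hom_extension A) (l20 (hom_extension A) Z X) Y
      + l1 (hom_extension A) (l3 (hom_extension A) X Y Z)), w\<rangle> = \<langle>snd 0, w\<rangle>"
      by (simp add: ext lins jac act l1_l21[OF A] order rotate coherence)
  qed (use l1_l3[OF A] in \<open>simp add: ext\<close>)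
  show ?thesis
    unfolding two_term_Linf_iff
    by (intro conjI allI; (rule lin alternating d_bracket jacobi)?; unfold ext;
        (rule l3_alternating[OF A] l21_l1[OF A] l3_l1[OF A] l3_coherence[OF A]))
qed

end

section \<open>The tilde algebra as a twist\<close>

text \<open>The argument of \<open>tensor_lift b\<close> enters only through the second slot of
  \<open>b\<close>; the first holds fixed basis covectors.\<close>

lemma linear_tensor_lift_right:
  assumes "\<And>\<xi>. linear (b \<xi>)"
  shows "linear (tensor_lift b)"
  by (rule linearI)
    (simp_all add: tensor_lift_def linear_add[OF assms] linear_cmul[OF assms] sum.distrib scaleR_sum_right)

text \<open>The \<open>F2\<close> of the theorem, in a form free of tensors.\<close>

definition contract ::
  "'a::real_vector \<times> ('a, 'b::real_vector) linmap \<Rightarrow> 'a \<times> ('a, 'b) linmap \<Rightarrow> 'b"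
  where "contract X Y = (1/2) *\<^sub>R (\<langle>snd X, fst Y\<rangle> - \<langle>snd Y, fst X\<rangle>)"

lemma bilinear_contract: "bilinear contract"
  unfolding bilinear_def contract_def
  by (auto intro!: linearI simp: linear_simps[OF linear_app] algebra_simps)

lemma contract_alternating: "contract X X = 0"
  by (simp add: contract_def)

lemma scaleR_numeral:
  fixes v :: "'a::real_vector"
  shows "4 *\<^sub>R v = v + v + v + v" "3 *\<^sub>R v = v + v + v" "2 *\<^sub>R v = v + v"
  using scaleR_left_distrib[of 1 1 v] scaleR_left_distrib[of 1 2 v] scaleR_left_distrib[of 2 2 v]
  by simp_all

context
  fixes A :: "('a::fin_dim_real_vector, 'b::fin_dim_real_vector) two_term"
  assumes A: "two_term_Linf A"
begin

text \<open>Both sides are linear in \<open>\<phi>\<close>, so it is enough to compare them on pure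
  tensors.\<close>

lemma app_tl20_mixed:
  "fst (tl20_mixed A x \<phi>) = - (1/2) *\<^sub>R l1 A \<langle>\<phi>, x\<rangle>"
  "\<langle>snd (tl20_mixed A x \<phi>), z\<rangle> =
    l21 A x \<langle>\<phi>, z\<rangle> - \<langle>\<phi>, l20 A x z\<rangle> - (1/2) *\<^sub>R l21 A z \<langle>\<phi>, x\<rangle>"
proof -
  note lins = multilinear[OF A] linear_simps[OF linear_app]
  have neg: "\<langle>neg_transpose (l20 A x) \<xi>, v\<rangle> = - \<langle>\<xi>, l20 A x v\<rangle>" for \<xi> v
    using lin(2)[OF A] by (intro app_neg_transpose[OF A]) (simp add: bilinear_def)
  have l: "linear (tl20_mixed A x)"
    unfolding tl20_mixed_def
    by (rule linear_tensor_lift_right, rule linearI)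
      (rule prod_linmap_eqI; simp add: lins app_l21op[OF A] l21op_def neg algebra_simps)+
  have "(\<lambda>\<phi>. fst (tl20_mixed A x \<phi>)) = (\<lambda>\<phi>. - (1/2) *\<^sub>R l1 A \<langle>\<phi>, x\<rangle>)"
    by (rule linear_eq_on_tensors)
      (auto intro!: linearI simp: linear_simps[OF l] lins tl20_mixed_tensor[OF A] algebra_simps)
  then show "fst (tl20_mixed A x \<phi>) = - (1/2) *\<^sub>R l1 A \<langle>\<phi>, x\<rangle>"
    by (rule fun_cong)
  have "(\<lambda>\<phi>. \<langle>snd (tl20_mixed A x \<phi>), z\<rangle>) =
      (\<lambda>\<phi>. l21 A x \<langle>\<phi>, z\<rangle> - \<langle>\<phi>, l20 A x z\<rangle> - (1/2) *\<^sub>R l21 A z \<langle>\<phi>, x\<rangle>)"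
    by (rule linear_eq_on_tensors)
      (auto intro!: linearI simp: linear_simps[OF l] lins tl20_mixed_tensor[OF A] app_l21op[OF A]
        l21op_def neg algebra_simps)
  then show "\<langle>snd (tl20_mixed A x \<phi>), z\<rangle> =
      l21 A x \<langle>\<phi>, z\<rangle> - \<langle>\<phi>, l20 A x z\<rangle> - (1/2) *\<^sub>R l21 A z \<langle>\<phi>, x\<rangle>"
    by (rule fun_cong)
qed

text \<open>Comparison on pure tensors twice: first in \<open>\<psi>\<close> with
  \<open>\<phi>\<close> a pure tensor, then in \<open>\<phi>\<close> with \<open>\<psi>\<close>
  arbitrary.\<close>

lemma app_tl20_hom: "\<langle>tl20_hom A \<phi> \<psi>, z\<rangle> = \<langle>\<phi>, l1 A \<langle>\<psi>, z\<rangle>\<rangle> - \<langle>\<psi>, l1 A \<langle>\<phi>, z\<rangle>\<rangle>"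
proof -
  note lins = multilinear[OF A] linear_simps[OF linear_app]
  note neg = app_neg_transpose[OF A lin(1)[OF A]]
  define b where "b = (\<lambda>\<xi> m (\<eta> :: 'a dual) (n :: 'b).
    \<langle>neg_transpose (l1 A) \<eta>, m\<rangle> *\<^sub>R (\<xi> \<otimes> n) - \<langle>neg_transpose (l1 A) \<xi>, n\<rangle> *\<^sub>R (\<eta> \<otimes> m))"
  have tl20_hom_b: "tl20_hom A \<phi> \<psi> = tensor_lift (\<lambda>\<xi> m. tensor_lift (b \<xi> m) \<psi>) \<phi>" for \<phi> \<psi>
    by (simp add: tl20_hom_def b_def)
  have b: "linear (\<lambda>m. b \<xi> m \<eta> n)" "linear (b \<xi> m \<eta>)" for \<xi> m \<eta> n
    unfolding b_def by (auto intro!: linearI linmap_eqI simp: lins neg algebra_simps)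
  have "linear (\<lambda>m. tensor_lift (b \<xi> m) \<psi>)" for \<xi> \<psi>
    unfolding tensor_lift_def by (intro linear_compose_sum ballI b(1))
  then have l: "linear (\<lambda>\<phi>. tl20_hom A \<phi> \<psi>)" for \<psi>
    unfolding tl20_hom_b by (rule linear_tensor_lift_right)
  have r: "linear (tl20_hom A (\<xi> \<otimes> m))" for \<xi> m
  proof -
    have "linear (tensor_lift (b \<zeta> n))" for \<zeta> n
      by (rule linear_tensor_lift_right) (rule b(2))
    then show ?thesis
      unfolding tl20_hom_b tensor_lift_def[of _ "\<xi> \<otimes> m"]
      by (intro linear_compose_sum ballI)
  qed
  have "(\<lambda>\<psi>. \<langle>tl20_hom A (\<xi> \<otimes> m) \<psi>, z\<rangle>) =
      (\<lambda>\<psi>. \<langle>\<xi> \<otimes> m, l1 A \<langle>\<psi>, z\<rangle>\<rangle> - \<langle>\<psi>, l1 A \<langle>\<xi> \<otimes> m, z\<rangle>\<rangle>)" for \<xi> m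
    by (rule linear_eq_on_tensors)
      (auto intro!: linearI simp: linear_simps[OF r] lins neg tl20_hom_tensors[OF A] algebra_simps)
  then have "(\<lambda>\<phi>. \<langle>tl20_hom A \<phi> \<psi>, z\<rangle>) = (\<lambda>\<phi>. \<langle>\<phi>, l1 A \<langle>\<psi>, z\<rangle>\<rangle> - \<langle>\<psi>, l1 A \<langle>\<phi>, z\<rangle>\<rangle>)"
    by (intro linear_eq_on_tensors)
      (auto intro!: linearI simp: linear_simps[OF l] lins fun_eq_iff algebra_simps)
  then show ?thesis
    by (rule fun_cong)
qed

text \<open>Every lift in \<open>tl3\<close> is a contraction. In the nested ones the inner lift
  evaluates one Hom element at \<open>l1 A m\<close>, and the outer lift then contracts against the
  linear map \<open>m \<mapsto> \<langle>f, l1 A m\<rangle>\<close>.\<close>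

lemma tl3_eq:
  "tl3 A (x, \<phi>) (y, \<psi>) (z, \<chi>) =
    - (1/2) *\<^sub>R l3 A x y z
    - (1/2) *\<^sub>R (\<langle>\<chi>, l20 A x y\<rangle> + \<langle>\<phi>, l20 A y z\<rangle> + \<langle>\<psi>, l20 A z x\<rangle>)
    - (1/4) *\<^sub>R ((\<langle>\<chi>, l1 A \<langle>\<phi>, y\<rangle>\<rangle> - \<langle>\<chi>, l1 A \<langle>\<psi>, x\<rangle>\<rangle>)
      + (\<langle>\<phi>, l1 A \<langle>\<psi>, z\<rangle>\<rangle> - \<langle>\<phi>, l1 A \<langle>\<chi>, y\<rangle>\<rangle>)
      + (\<langle>\<psi>, l1 A \<langle>\<chi>, x\<rangle>\<rangle> - \<langle>\<psi>, l1 A \<langle>\<phi>, z\<rangle>\<rangle>))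
    - (1/4) *\<^sub>R ((l21 A x \<langle>\<psi>, z\<rangle> - l21 A x \<langle>\<chi>, y\<rangle>)
      + (l21 A y \<langle>\<chi>, x\<rangle> - l21 A y \<langle>\<phi>, z\<rangle>)
      + (l21 A z \<langle>\<phi>, y\<rangle> - l21 A z \<langle>\<psi>, x\<rangle>))"
proof -
  note contr = tensor_lift_contract[OF A]
  have l: "linear (l21 A x)" for x
    using lin(3)[OF A] unfolding bilinear_def by blast
  have scaled: "tensor_lift (\<lambda>\<eta> n. (c * \<langle>\<eta>, v\<rangle>) *\<^sub>R n) f = c *\<^sub>R \<langle>f, v\<rangle>"
    for c v and f :: "('a, 'b) linmap"
    using contr[OF linear_compose_scale_right[OF linear_ident], of v c f]
    by (simp only: scaleR_scaleR mult.commute)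
  have comp: "linear (\<lambda>m. \<langle>f, l1 A m\<rangle>)" for f :: "('a, 'b) linmap"
    using linear_compose[OF lin(1)[OF A] linear_app, of f] by (simp add: o_def)
  show ?thesis
    unfolding tl3_def cyc_def
    by (simp only: prod.case fst_conv scaled contr[OF linear_ident] contr[OF comp] contr[OF l])
qed

text \<open>The fractions in \<open>tilde\<close> come from the twist. For instance
  \<open>contract\<close> adds half of \<open>\<langle>\<phi>, l1 A m\<rangle> - l21 A x m\<close>
  to the action, and the three cyclic terms subtract \<open>3/2\<close> of
  \<open>l3 A x y z\<close>, leaving \<open>-1/2\<close>.\<close>

lemma tilde_eq_twist: "tilde A = twist (hom_extension A) contract"
proof -
  note lins = multilinear[OF A] linear_simps[OF linear_app]
  note ext = hom_extension_simps[OF A]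
  have "tl1 A = l1 (hom_extension A)"
    by (simp add: hom_extension_def)
  moreover have "tl20 A X Y = l20 (hom_extension A) X Y + l1 (hom_extension A) (contract X Y)" for X Y
    by (rule prod_linmap_eqI)
      (simp_all add: tl20_def case_prod_unfold app_tl20_mixed app_tl20_hom app_l3[OF A] ext
        contract_def lins scaleR_diff_right)
  moreover have "tl21 A X m = l21 (hom_extension A) X m + contract X (l1 (hom_extension A) m)" for X m
  proof -
    have half: "(1/2) *\<^sub>R a + (1/2) *\<^sub>R b = a + (1/2) *\<^sub>R (b - a)" for a b :: 'b
      using scaleR_half_double[of a] by (simp only: scaleR_right_distrib) (simp add: algebra_simps)
    show ?thesis
      by (simp only: tl21_def case_prod_unfold tensor_lift_contract[OF A linear_ident] ext contract_def half)
  qed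
  moreover have "tl3 A X Y Z = l3 (hom_extension A) X Y Z
      + cyc (\<lambda>X Y Z. l21 (hom_extension A) X (contract Y Z)) X Y Z
      - cyc (\<lambda>X Y Z. contract (l20 (hom_extension A) X Y
          + l1 (hom_extension A) (contract X Y)) Z) X Y Z" for X Y Z
  proof -
    obtain x \<phi> y \<psi> z \<chi> where [simp]: "X = (x, \<phi>)" "Y = (y, \<psi>)" "Z = (z, \<chi>)"
      by (metis prod.exhaust)
    have order: "l20 A z x = - l20 A x z" "l20 A z y = - l20 A y z" "l20 A y x = - l20 A x y"
      by (rule l20_skew[OF A])+
    \<comment> \<open>The factor 4 clears the products of two halves; \<open>scaleR_numeral\<close>
      then turns integer multiples into repeated sums, which cancel term by term.\<close>
    have "4 *\<^sub>R tl3 A X Y Z = 4 *\<^sub>R (l3 (hom_extension A) X Y Z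
      + cyc (\<lambda>X Y Z. l21 (hom_extension A) X (contract Y Z)) X Y Z
      - cyc (\<lambda>X Y Z. contract (l20 (hom_extension A) X Y
          + l1 (hom_extension A) (contract X Y)) Z) X Y Z)"
      by (simp add: tl3_eq cyc_def contract_def ext lins order l3_cycle[OF A, where x = x and y = y and z = z]
          scaleR_right_distrib scaleR_right_diff_distrib scaleR_numeral)
    then show ?thesis
      by (simp only: scaleR_cancel_left) simp
  qed
  ultimately show ?thesis
    by (simp add: tilde_def twist_def fun_eq_iff)
qed

end

section \<open>The homomorphism onto the original algebra\<close>

theorem theorem4p11:
  fixes \<gg> :: "('a::fin_dim_real_vector, 'b::fin_dim_real_vector) two_term"
  assumes "two_term_Linf \<gg>"
  shows "\<exists>F2. Linf_hom (tilde \<gg>) \<gg> fst id F2 \<and>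
    (\<forall>x y \<xi> m \<eta> n. F2 (x, \<xi> \<otimes> m) (y, \<eta> \<otimes> n) =
       (1/2) *\<^sub>R (\<langle>\<xi>, y\<rangle> *\<^sub>R m - \<langle>\<eta>, x\<rangle> *\<^sub>R n))"
proof (intro exI conjI allI)
  note ext = hom_extension_simps[OF assms]
  have "two_term_Linf (tilde \<gg>)"
    unfolding tilde_eq_twist[OF assms]
    by (intro two_term_Linf_twist two_term_Linf_hom_extension assms bilinear_contract contract_alternating)
  then show "Linf_hom (tilde \<gg>) \<gg> fst id contract"
    unfolding Linf_hom_def tilde_eq_twist[OF assms]
  \<comment> \<open>Under \<open>fst\<close>, each homomorphism equation is the definition of the
    matching operation of \<open>twist\<close>.\<close>
  proof (intro conjI allI)
    show "fst \<circ> l1 (twist (hom_extension \<gg>) contract) = l1 \<gg> \<circ> id"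
      by (simp add: twist_def fun_eq_iff ext)
  qed (simp_all add: assms bilinear_contract contract_alternating linear_fst linear_id twist_def ext cyc_def)
qed (simp add: contract_def)

end
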